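(* Let $X$ be a locally convex Hausdorff topological vector space and let $D\subset X$ be a closed convex set with nonempty relative interior. If $D$ has finitely many faces, then $D$ is a generalized polyhedral convex set.
   Context: $X$ is a real locally convex Hausdorff topological vector space, $X^*$ its (continuous) dual, and $\langle x^*,x\rangle$ the value of $x^*\in X^*$ at $x\in X$. A subset $D\subset X$ is a generalized polyhedral convex set if there exist $x_i^*\in X^*$, $\alpha_i\in\mathbb{R}$, $i=1,\dots,p$, and a closed affine subspace $L\subset X$ such that $D=\{x\in X\mid x\in L,\ \langle x_i^*,x\rangle\le\alpha_i,\ i=1,\dots,p\}$. The relative interior of a convex set $C\subset X$ is the interior of $C$ in the induced topology of the closed affine hull $\overline{\mathrm{aff}}\,C$ of $C$. A convex subset $F$ of a convex set $C$ is a face of $C$ if for all $x^1,x^2\in C$ with $(1-\lambda)x^1+\lambda x^2\in F$ for some $\lambda\in(0,1)$ one has $x^1\in F$ and $x^2\in F$. *)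

theory Defs
  imports "HOL-Analysis.Analysis"
begin

class real_tvs = real_vector + topological_ab_group_add +
  assumes tendsto_scaleR_Pair:
    "filterlim (\<lambda>p. fst p *\<^sub>R snd p) (nhds (c *\<^sub>R x)) (nhds c \<times>\<^sub>F nhds x)"

(* Convexity is unfolded because the library constant is not available for the
   type parameter of a class specification; see convex_nhd_zero below. *)
class real_lctvs = real_tvs +
  assumes convex_nhd_zero_raw:
    "open U \<Longrightarrow> 0 \<in> U \<Longrightarrow>
      \<exists>V. open V \<and> 0 \<in> V \<and> V \<subseteq> U \<and>
        (\<forall>x\<in>V. \<forall>y\<in>V. \<forall>u\<ge>0. \<forall>v\<ge>0. u + v = 1 \<longrightarrow> u *\<^sub>R x + v *\<^sub>R y \<in> V)"

lemma convex_nhd_zero: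
  fixes U :: "'a :: real_lctvs set"
  assumes "open U" "0 \<in> U"
  shows "\<exists>V. open V \<and> convex V \<and> 0 \<in> V \<and> V \<subseteq> U"
  using convex_nhd_zero_raw[OF assms] unfolding convex_def by blast

lemma continuous_scaleR_pair:
  "continuous_on UNIV (\<lambda>p :: real \<times> 'a :: real_tvs. fst p *\<^sub>R snd p)"
  unfolding continuous_on_def
proof
  fix p :: "real \<times> 'a"
  show "((\<lambda>p. fst p *\<^sub>R snd p) \<longlongrightarrow> fst p *\<^sub>R snd p) (at p)"
    using tendsto_scaleR_Pair[of "fst p" "snd p"]
    by (intro filterlim_mono[OF _ order_refl at_within_le_nhds]) (simp add: nhds_prod[symmetric])
qed

instance real_normed_vector < real_lctvs
proof
  fix c :: real and x :: 'a
  show "filterlim (\<lambda>p. fst p *\<^sub>R snd p) (nhds (c *\<^sub>R x)) (nhds c \<times>\<^sub>F nhds x)"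
    by (intro tendsto_scaleR filterlim_fst filterlim_snd)
next
  fix U :: "'a set"
  assume "open U" "0 \<in> U"
  then obtain e where e: "e > 0" "ball 0 e \<subseteq> U"
    using open_contains_ball by blast
  have "\<forall>x\<in>ball 0 e. \<forall>y\<in>ball 0 e. \<forall>u\<ge>0. \<forall>v\<ge>0.
          u + v = 1 \<longrightarrow> u *\<^sub>R x + v *\<^sub>R y \<in> ball (0 :: 'a) e"
    using convex_ball[of "0 :: 'a" e] unfolding convex_def .
  with e show "\<exists>V. open V \<and> 0 \<in> V \<and> V \<subseteq> U \<and>
      (\<forall>x\<in>V. \<forall>y\<in>V. \<forall>u\<ge>0. \<forall>v\<ge>0. u + v = 1 \<longrightarrow> u *\<^sub>R x + v *\<^sub>R y \<in> V)"
    by (intro exI[of _ "ball 0 e"]) simp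
qed

definition dual_space :: "('a :: real_tvs \<Rightarrow> real) set" where
  "dual_space = {f. linear f \<and> continuous_on UNIV f}"

definition generalized_polyhedral_convex :: "'a :: real_tvs set \<Rightarrow> bool" where
  "generalized_polyhedral_convex D \<longleftrightarrow>
     (\<exists>(p :: nat) (f :: nat \<Rightarrow> 'a \<Rightarrow> real) (\<alpha> :: nat \<Rightarrow> real) L.
        (\<forall>i\<in>{1..p}. f i \<in> dual_space) \<and> affine L \<and> closed L \<and>
        D = {x. x \<in> L \<and> (\<forall>i\<in>{1..p}. f i x \<le> \<alpha> i)})"

(* Unlike the library's rel_interior, this takes the interior relative to the closed affine
   hull; in infinite dimensions the affine hull itself need not be closed. *)
definition relative_interior :: "'a :: real_tvs set \<Rightarrow> 'a set" where
  "relative_interior C = top_of_set (closure (affine hull C)) interior_of C"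

end

theory Submission
  imports Defs
begin

text \<open>Fix \<open>u\<close> in the relative interior of \<open>D\<close> and let \<open>L\<close> be the closed affine hull. For \<open>x \<in> L - D\<close>
  the segment from \<open>u\<close> to \<open>x\<close> leaves \<open>D\<close> at a point \<open>z \<noteq> x\<close>, and Hahn-Banach gives a continuous
  functional attaining its maximum over \<open>D\<close> at \<open>z\<close> but not at \<open>u\<close>; the points of \<open>D\<close> where it is
  attained form a face. For each of the finitely many faces arising in this way keep a single such functional: it
  also equals its maximum at \<open>z\<close> and is smaller at \<open>u\<close>, hence it exceeds the maximum at \<open>x\<close>. So these finitely many
  half-spaces cut \<open>D\<close> out of \<open>L\<close>.\<close>

section \<open>Sublinear functionals and the Hahn-Banach theorem\<close>

definition sublinear :: "('a :: real_vector \<Rightarrow> real) \<Rightarrow> bool" where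
  "sublinear p \<longleftrightarrow> (\<forall>x y. p (x + y) \<le> p x + p y) \<and> (\<forall>c x. 0 \<le> c \<longrightarrow> p (c *\<^sub>R x) = c * p x)"

lemma sublinearI:
  assumes add: "\<And>x y. p (x + y) \<le> p x + p y"
    and zero: "p 0 = 0"
    and scale: "\<And>c x. 0 < c \<Longrightarrow> p (c *\<^sub>R x) \<le> c * p x"
  shows "sublinear p"
proof -
  have "p (c *\<^sub>R x) = c * p x" if "0 \<le> c" for c x
  proof (cases "c = 0")
    case False
    with that have c: "0 < c" by simp
    \<comment> \<open>The reverse inequality is \<open>scale\<close> itself, applied to
      \<open>inverse c\<close> and the point \<open>c *\<^sub>R x\<close>.\<close>
    have "p x \<le> inverse c * p (c *\<^sub>R x)"
      using scale[of "inverse c" "c *\<^sub>R x"] c by simp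
    hence "c * p x \<le> p (c *\<^sub>R x)"
      using c by (simp add: field_simps)
    with scale[OF c, of x] show ?thesis by simp
  qed (simp add: zero)
  with add show ?thesis by (auto simp: sublinear_def)
qed

lemma sublinear_add: "sublinear p \<Longrightarrow> p (x + y) \<le> p x + p y"
  and sublinear_scale: "sublinear p \<Longrightarrow> 0 \<le> c \<Longrightarrow> p (c *\<^sub>R x) = c * p x"
  by (auto simp: sublinear_def)

lemma sublinear_zero: "sublinear p \<Longrightarrow> p 0 = 0"
  using sublinear_scale[of p 0 0] by simp

lemma sublinear_neg: "sublinear p \<Longrightarrow> - p (- x) \<le> p x"
  using sublinear_add[of p x "- x"] sublinear_zero[of p] by simp

text \<open>Take the infimum of \<open>p (x + t *\<^sub>R a) - t * p a\<close> over t \<ge> 0: t = 0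
  and t = 1 give the two bounds. At \<open>- a\<close> the second bound reads
  \<open>q (- a) \<le> - p a\<close>, so every linear functional below \<open>q\<close> takes at
  least the value \<open>p a\<close> at \<open>a\<close>.\<close>

lemma sublinear_tilt:
  assumes p: "sublinear p"
  obtains q where "sublinear q" "\<And>x. q x \<le> p x" "\<And>x. q x \<le> p (x + a) - p a"
proof -
  define h where "h x t = p (x + t *\<^sub>R a) - t * p a" for x t
  define q where "q x = (INF t\<in>{0..}. h x t)" for x
  \<comment> \<open>This bound does not depend on \<open>t\<close>, so the infimum defining
    \<open>q\<close> is finite.\<close>
  have lower: "- p (- x) \<le> h x t" if "0 \<le> t" for x t
    using sublinear_add[OF p, of "x + t *\<^sub>R a" "- x"] sublinear_scale[OF p that, of a]
    by (simp add: h_def)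
  have bdd: "bdd_below (h x ` {0..})" for x
    using lower by (intro bdd_belowI2[where m = "- p (- x)"]) auto
  have q_le: "q x \<le> h x t" if "0 \<le> t" for x t
    unfolding q_def using bdd that by (intro cINF_lower) auto
  have q_ge: "m \<le> q x" if "\<And>t. 0 \<le> t \<Longrightarrow> m \<le> h x t" for m x
    unfolding q_def using that by (intro cINF_greatest) auto
  have "sublinear q"
  proof (rule sublinearI)
    fix x y
    have "q (x + y) - h y s \<le> q x" if s: "0 \<le> s" for s
    proof (rule q_ge)
      fix t :: real assume t: "0 \<le> t"
      \<comment> \<open>Parameters chosen separately for \<open>x\<close> and \<open>y\<close> are
        added; the terms in \<open>p a\<close> then match exactly.\<close>
      have "q (x + y) \<le> h (x + y) (t + s)"
        using s t by (intro q_le) simp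
      also have "\<dots> \<le> h x t + h y s"
        using sublinear_add[OF p, of "x + t *\<^sub>R a" "y + s *\<^sub>R a"]
        by (simp add: h_def algebra_simps)
      finally show "q (x + y) - h y s \<le> h x t" by simp
    qed
    hence "q (x + y) - q x \<le> q y"
      by (intro q_ge) (simp add: algebra_simps)
    thus "q (x + y) \<le> q x + q y" by simp
  next
    show "q 0 = 0"
    proof (rule antisym)
      show "q 0 \<le> 0" using q_le[of 0 0] sublinear_zero[OF p] by (simp add: h_def)
      show "0 \<le> q 0" using lower[of _ 0] sublinear_zero[OF p] by (intro q_ge) simp
    qed
  next
    fix c :: real and x assume c: "0 < c"
    have "q (c *\<^sub>R x) / c \<le> q x"
    proof (rule q_ge)
      fix t :: real assume t: "0 \<le> t"
      have "q (c *\<^sub>R x) \<le> h (c *\<^sub>R x) (c * t)"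
        using c t by (intro q_le) simp
      also have "\<dots> = c * h x t"
        using sublinear_scale[OF p, of c "x + t *\<^sub>R a"] c
        by (simp add: h_def algebra_simps)
      finally show "q (c *\<^sub>R x) / c \<le> h x t" using c by (simp add: field_simps)
    qed
    thus "q (c *\<^sub>R x) \<le> c * q x" using c by (simp add: field_simps)
  qed
  moreover have "q x \<le> p x" for x using q_le[of 0 x] by (simp add: h_def)
  moreover have "q x \<le> p (x + a) - p a" for x using q_le[of 1 x] by (simp add: h_def)
  ultimately show thesis by (rule that)
qed

text \<open>Provides the lower bounds for Zorn's lemma. Comparability is used twice: comparison with
  one fixed member keeps the infimum finite, and the smaller of two members serves both summands in
  subadditivity.\<close>

lemma sublinear_INF_chain:
  assumes sub: "\<And>p. p \<in> C \<Longrightarrow> sublinear p" and "C \<noteq> {}"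
    and chain: "\<And>p q. p \<in> C \<Longrightarrow> q \<in> C \<Longrightarrow> p \<le> q \<or> q \<le> p"
  shows "sublinear (\<lambda>x. INF p\<in>C. p x)" "\<And>p x. p \<in> C \<Longrightarrow> (INF p\<in>C. p x) \<le> p x"
proof -
  obtain p0 where p0: "p0 \<in> C" using \<open>C \<noteq> {}\<close> by blast
  have bdd: "bdd_below ((\<lambda>p. p x) ` C)" for x
  proof (rule bdd_belowI2[where m = "- p0 (- x)"])
    fix p assume p: "p \<in> C"
    from chain[OF p p0] show "- p0 (- x) \<le> p x"
    proof
      assume "p \<le> p0"
      hence "p (- x) \<le> p0 (- x)" by (rule le_funD)
      with sublinear_neg[OF sub[OF p], of x] show ?thesis by simp
    next
      assume "p0 \<le> p"
      hence "p0 x \<le> p x" by (rule le_funD)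
      with sublinear_neg[OF sub[OF p0], of x] show ?thesis by simp
    qed
  qed
  show le: "(INF p\<in>C. p x) \<le> p x" if "p \<in> C" for p x
    using bdd that by (rule cINF_lower)
  show "sublinear (\<lambda>x. INF p\<in>C. p x)"
  proof (rule sublinearI)
    fix x y
    have "(INF p\<in>C. p (x + y)) \<le> p x + q y" if p: "p \<in> C" and q: "q \<in> C" for p q
    proof -
      obtain r where r: "r \<in> C" "r \<le> p" "r \<le> q"
        using chain[OF p q] p q by blast
      have "(INF p\<in>C. p (x + y)) \<le> r x + r y"
        using le[OF r(1), of "x + y"] sublinear_add[OF sub[OF r(1)], of x y] by linarith
      also have "\<dots> \<le> p x + q y" using r(2,3) by (auto simp: le_fun_def intro: add_mono)
      finally show ?thesis .
    qed
    hence "(INF p\<in>C. p (x + y)) - q y \<le> (INF p\<in>C. p x)" if "q \<in> C" for q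
      using that \<open>C \<noteq> {}\<close> by (intro cINF_greatest) (auto simp: algebra_simps)
    hence "(INF p\<in>C. p (x + y)) - (INF p\<in>C. p x) \<le> (INF p\<in>C. p y)"
      using \<open>C \<noteq> {}\<close> by (intro cINF_greatest) (auto simp: algebra_simps)
    thus "(INF p\<in>C. p (x + y)) \<le> (INF p\<in>C. p x) + (INF p\<in>C. p y)" by simp
  next
    have "(\<lambda>p. p 0) ` C = {0}"
      using sublinear_zero[OF sub] p0 by (auto intro: image_eqI[OF _ p0])
    thus "(INF p\<in>C. p 0) = 0" by simp
  next
    fix c :: real and x assume c: "0 < c"
    have "(INF p\<in>C. p (c *\<^sub>R x)) / c \<le> (INF p\<in>C. p x)"
    proof (rule cINF_greatest)
      fix p assume p: "p \<in> C"
      show "(INF p\<in>C. p (c *\<^sub>R x)) / c \<le> p x"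
        using le[OF p, of "c *\<^sub>R x"] sublinear_scale[OF sub[OF p], of c x] c
        by (simp add: field_simps)
    qed fact
    thus "(INF p\<in>C. p (c *\<^sub>R x)) \<le> c * (INF p\<in>C. p x)"
      using c by (simp add: field_simps)
  qed
qed

text \<open>A sublinear functional that is minimal in the pointwise order is linear, because
  \<open>sublinear_tilt\<close> cannot lower it.\<close>

lemma minimal_sublinear_linear:
  assumes q: "sublinear q" and minimal: "\<And>r. sublinear r \<Longrightarrow> r \<le> q \<Longrightarrow> r = q"
  shows "linear q"
proof -
  have add: "q (x + a) = q x + q a" for x a
  proof -
    obtain r where r: "sublinear r" "\<And>x. r x \<le> q x" "\<And>x. r x \<le> q (x + a) - q a"
      using sublinear_tilt[OF q] by blast
    have "r = q" using r(1,2) by (intro minimal) (auto simp: le_fun_def)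
    with r(3)[of x] sublinear_add[OF q, of x a] show ?thesis by simp
  qed
  have neg: "q (- x) = - q x" for x
    using add[of x "- x"] sublinear_zero[OF q] by simp
  have "q (c *\<^sub>R x) = c * q x" for c x
  proof (cases "0 \<le> c")
    case False
    thus ?thesis
      using sublinear_scale[OF q, of "- c" x] neg[of "c *\<^sub>R x"] by simp
  qed (rule sublinear_scale[OF q])
  with add show ?thesis by (intro linearI) simp_all
qed

lemma minimal_sublinear_exists:
  assumes p: "sublinear p"
  obtains q where "sublinear q" "q \<le> p" "\<And>r. sublinear r \<Longrightarrow> r \<le> q \<Longrightarrow> r = q"
proof -
  define A where "A = {q. sublinear q \<and> q \<le> p}"
  have "\<exists>m\<in>A. \<forall>a\<in>A. a \<le> m \<longrightarrow> a = m"
  \<comment> \<open>The order is reversed, so the maximal element supplied by Zorn is minimal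
    pointwise.\<close>
  proof (rule predicate_Zorn[where P = "\<lambda>x y. y \<le> x"])
    show "partial_order_on A (relation_of (\<lambda>x y. y \<le> x) A)"
      by (rule partial_order_on_relation_ofI) auto
  next
    fix C assume C: "C \<in> Chains (relation_of (\<lambda>x y. y \<le> x) A)"
    hence CA: "C \<subseteq> A" and chain: "\<And>p q. p \<in> C \<Longrightarrow> q \<in> C \<Longrightarrow> p \<le> q \<or> q \<le> p"
      by (auto simp: Chains_def relation_of_def)
    show "\<exists>u\<in>A. \<forall>a\<in>C. u \<le> a"
    proof (cases "C = {}")
      case True
      thus ?thesis using p by (auto simp: A_def)
    next
      case False
      have sub: "sublinear p" if "p \<in> C" for p using that CA by (auto simp: A_def)
      have inf: "sublinear (\<lambda>x. INF p\<in>C. p x)" "\<And>p x. p \<in> C \<Longrightarrow> (INF p\<in>C. p x) \<le> p x"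
        using sublinear_INF_chain[of C] sub False chain by blast+
      have "(\<lambda>x. INF p\<in>C. p x) \<le> q" if "q \<in> C" for q
        using inf(2)[OF that] by (auto simp: le_fun_def)
      moreover from this have "(\<lambda>x. INF p\<in>C. p x) \<in> A"
        using inf(1) False CA unfolding A_def by (blast intro: order_trans)
      ultimately show ?thesis by blast
    qed
  qed
  thus thesis using that by (auto simp: A_def intro: order_trans)
qed

text \<open>Tilting at \<open>a\<close> comes before minimising: a minimal functional below the
  tilted one is linear, and its bound at \<open>- a\<close> turns into equality with
  \<open>p\<close> at \<open>a\<close>. No extension from a subspace is involved.\<close>

lemma hahn_banach_point:
  assumes p: "sublinear p"
  obtains f where "linear f" "\<And>x. f x \<le> p x" "f a = p a"
proof -
  obtain q where q: "sublinear q" "\<And>x. q x \<le> p x" "\<And>x. q x \<le> p (x + a) - p a"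
    using sublinear_tilt[OF p] by blast
  obtain f where f: "sublinear f" "f \<le> q" "\<And>r. sublinear r \<Longrightarrow> r \<le> f \<Longrightarrow> r = f"
    using minimal_sublinear_exists[OF q(1)] by blast
  have lin: "linear f" using f(1,3) by (rule minimal_sublinear_linear)
  have le: "f x \<le> p x" for x
    using f(2) q(2)[of x] by (auto simp: le_fun_def intro: order_trans)
  have "f (- a) \<le> - p a"
    using f(2) q(3)[of "- a"] sublinear_zero[OF p] by (auto simp: le_fun_def intro: order_trans)
  hence "p a \<le> f a" by (simp add: linear_neg[OF lin])
  with le[of a] have "f a = p a" by simp
  with lin le show thesis by (rule that)
qed

section \<open>Minkowski gauges of absorbing convex sets\<close>

definition gauge_set :: "'a :: real_vector set \<Rightarrow> 'a \<Rightarrow> real set" where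
  "gauge_set C x = {s. 0 < s \<and> inverse s *\<^sub>R x \<in> C}"

definition minkowski :: "'a :: real_vector set \<Rightarrow> 'a \<Rightarrow> real" where
  "minkowski C x = Inf (gauge_set C x)"

lemma minkowski_le: "0 < s \<Longrightarrow> inverse s *\<^sub>R x \<in> C \<Longrightarrow> minkowski C x \<le> s"
  unfolding minkowski_def by (rule cInf_lower) (auto simp: gauge_set_def intro!: bdd_belowI[where m = 0])

text \<open>Absorption makes the gauge set nonempty, without which its \<open>Inf\<close> would
  carry no information.\<close>

lemma minkowski_ge:
  assumes "\<And>x. \<exists>s>0. inverse s *\<^sub>R x \<in> C"
    and "\<And>s. 0 < s \<Longrightarrow> inverse s *\<^sub>R x \<in> C \<Longrightarrow> m \<le> s"
  shows "m \<le> minkowski C x"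
  unfolding minkowski_def using assms by (intro cInf_greatest) (auto simp: gauge_set_def)

lemma sublinear_minkowski:
  assumes C: "convex C" and absorb: "\<And>x. \<exists>s>0. inverse s *\<^sub>R x \<in> C"
  shows "sublinear (minkowski C)"
proof (rule sublinearI)
  fix x y
  have sum: "minkowski C (x + y) \<le> s + t"
    if s: "0 < s" "inverse s *\<^sub>R x \<in> C" and t: "0 < t" "inverse t *\<^sub>R y \<in> C" for s t
  proof (rule minkowski_le)
    \<comment> \<open>These weights cancel the two different scalings and leave the common factor
      \<open>inverse (s + t)\<close>.\<close>
    have "(s / (s + t)) *\<^sub>R (inverse s *\<^sub>R x) + (t / (s + t)) *\<^sub>R (inverse t *\<^sub>R y) \<in> C"
      using C s t by (intro convexD) (auto simp: add_divide_distrib[symmetric])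
    moreover have "(s / (s + t)) *\<^sub>R (inverse s *\<^sub>R x) + (t / (s + t)) *\<^sub>R (inverse t *\<^sub>R y)
        = inverse (s + t) *\<^sub>R (x + y)"
      using s t by (simp add: scaleR_add_right divide_inverse mult.assoc mult.left_commute[of _ "inverse (s + t)"])
    ultimately show "inverse (s + t) *\<^sub>R (x + y) \<in> C" by simp
  qed (use s t in simp)
  have "minkowski C (x + y) - t \<le> minkowski C x" if "0 < t" "inverse t *\<^sub>R y \<in> C" for t
    using sum[OF _ _ that] by (intro minkowski_ge[OF absorb]) (simp add: algebra_simps)
  hence "minkowski C (x + y) - minkowski C x \<le> minkowski C y"
    by (intro minkowski_ge[OF absorb]) (simp add: algebra_simps)
  thus "minkowski C (x + y) \<le> minkowski C x + minkowski C y" by simp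
next
  have "0 \<in> C" using absorb[of 0] by simp
  hence "minkowski C 0 \<le> s" if "0 < s" for s :: real
    using that by (intro minkowski_le) simp_all
  hence "minkowski C 0 \<le> 0" by (rule field_le_epsilon[of _ 0, simplified])
  moreover have "0 \<le> minkowski C 0" by (rule minkowski_ge[OF absorb]) simp
  ultimately show "minkowski C 0 = 0" by simp
next
  fix c :: real and x assume c: "0 < c"
  have "minkowski C (c *\<^sub>R x) / c \<le> minkowski C x"
  proof (rule minkowski_ge[OF absorb])
    fix s :: real assume "0 < s" "inverse s *\<^sub>R x \<in> C"
    hence "minkowski C (c *\<^sub>R x) \<le> c * s"
      using c by (intro minkowski_le) (simp_all add: field_simps)
    thus "minkowski C (c *\<^sub>R x) / c \<le> s" using c by (simp add: field_simps)
  qed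
  thus "minkowski C (c *\<^sub>R x) \<le> c * minkowski C x" using c by (simp add: field_simps)
qed

text \<open>Some \<open>t < s\<close> already scales \<open>x\<close> into \<open>C\<close>, and the
  point for \<open>s\<close> lies between that one and the origin.\<close>

lemma minkowski_less_imp_mem:
  assumes C: "convex C" and absorb: "\<And>x. \<exists>s>0. inverse s *\<^sub>R x \<in> C"
    and less: "minkowski C x < s"
  shows "inverse s *\<^sub>R x \<in> C"
proof -
  obtain t where t: "0 < t" "inverse t *\<^sub>R x \<in> C" "t < s"
    using minkowski_ge[OF absorb, of x s] less by (meson not_le)
  have "0 \<in> C" using absorb[of 0] by simp
  hence "(1 - t / s) *\<^sub>R 0 + (t / s) *\<^sub>R (inverse t *\<^sub>R x) \<in> C"
    using C t by (intro convexD) auto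
  moreover have "t / s * inverse t = inverse s" using t by (simp add: field_simps)
  ultimately show ?thesis by simp
qed

section \<open>Continuity and closure in topological vector spaces\<close>

lemma continuous_on_scaleR_tvs [continuous_intros]:
  fixes g :: "'b :: topological_space \<Rightarrow> 'a :: real_tvs"
  assumes "continuous_on S f" "continuous_on S g"
  shows "continuous_on S (\<lambda>x. f x *\<^sub>R g x)"
  using continuous_on_compose2[OF continuous_scaleR_pair continuous_on_Pair[OF assms]] by simp

lemma open_absorbing:
  fixes x :: "'a :: real_tvs"
  assumes "open V" "0 \<in> V"
  shows "\<exists>s>0. inverse s *\<^sub>R x \<in> V"
proof -
  have "open ((\<lambda>t. t *\<^sub>R x) -` V)"
    using assms(1) by (intro open_vimage continuous_intros)
  moreover have "0 \<in> (\<lambda>t. t *\<^sub>R x) -` V" using assms(2) by simp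
  ultimately obtain e where e: "e > 0" "ball 0 e \<subseteq> (\<lambda>t. t *\<^sub>R x) -` V"
    by (rule openE)
  have "e / 2 \<in> ball 0 e" using e(1) by (simp add: dist_real_def)
  hence "(e / 2) *\<^sub>R x \<in> V" using e(2) by blast
  thus ?thesis using e(1) by (intro exI[of _ "inverse (e / 2)"]) simp
qed

text \<open>A one-sided bound suffices because it can be applied to both signs of a small difference
  \<open>y - x\<close>.\<close>

lemma linear_bounded_above_continuous:
  fixes f :: "'a :: real_tvs \<Rightarrow> real"
  assumes f: "linear f" and V: "open V" "0 \<in> V" and le: "\<And>x. x \<in> V \<Longrightarrow> f x \<le> 1"
  shows "continuous_on UNIV f"
  unfolding continuous_on_def
proof (intro ballI tendstoI)
  fix x and e :: real assume e: "0 < e"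
  \<comment> \<open>The factor 2 makes the difference of values at most \<open>e / 2\<close>, hence
    strictly below \<open>e\<close>.\<close>
  define W where "W = (\<lambda>y. (2 / e) *\<^sub>R (y - x)) -` V \<inter> (\<lambda>y. (- 2 / e) *\<^sub>R (y - x)) -` V"
  have "open W"
    unfolding W_def using V by (intro open_Int open_vimage continuous_intros)
  moreover have "x \<in> W" using V by (simp add: W_def)
  moreover have "dist (f y) (f x) < e" if "y \<in> W" for y
  proof -
    have "f ((2 / e) *\<^sub>R (y - x)) \<le> 1" "f ((- 2 / e) *\<^sub>R (y - x)) \<le> 1"
      using that by (auto simp: W_def intro!: le)
    hence "(2 / e) * (f y - f x) \<le> 1" "(- 2 / e) * (f y - f x) \<le> 1"
      by (simp_all only: linear_scale[OF f] linear_diff[OF f] real_scaleR_def)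
    thus ?thesis using e by (simp add: dist_real_def field_simps abs_if)
  qed
  ultimately show "\<forall>\<^sub>F y in at x. dist (f y) (f x) < e"
    unfolding eventually_at_topological by blast
qed

lemma affine_closure_tvs:
  fixes S :: "'a :: real_tvs set"
  assumes "affine S"
  shows "affine (closure S)"
  unfolding affine_def
proof (intro ballI allI impI)
  fix x y and u v :: real
  assume xy: "x \<in> closure S" "y \<in> closure S" and uv: "u + v = 1"
  let ?h = "\<lambda>z. u *\<^sub>R fst z + v *\<^sub>R snd z"
  have "?h ` closure (S \<times> S) \<subseteq> closure S"
  proof (rule image_closure_subset)
    show "continuous_on (closure (S \<times> S)) ?h" by (intro continuous_intros)
    show "?h ` (S \<times> S) \<subseteq> closure S"
      using assms uv closure_subset[of S] by (auto simp: affine_def)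
  qed simp
  moreover have "(x, y) \<in> closure (S \<times> S)" using xy by (simp add: closure_Times)
  ultimately show "u *\<^sub>R x + v *\<^sub>R y \<in> closure S" by fastforce
qed

section \<open>Convex hulls of unions and the supporting functional\<close>

lemma convex_nonneg_combination:
  assumes S: "convex S" and st: "s \<in> S" "t \<in> S" and ab: "0 \<le> a" "0 \<le> b"
  obtains w where "w \<in> S" "a *\<^sub>R s + b *\<^sub>R t = (a + b) *\<^sub>R w"
proof (cases "a + b = 0")
  case True
  with ab have "a = 0" "b = 0" by auto
  with st that[of s] show thesis by simp
next
  case False
  have "(a / (a + b)) *\<^sub>R s + (b / (a + b)) *\<^sub>R t \<in> S"
    using S st ab False by (intro convexD) (auto simp: add_divide_distrib[symmetric])
  with False that show thesis by (simp add: scaleR_add_right)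
qed

text \<open>The two-point combinations already form a convex set: in a mixture of two of them, the
  terms from \<open>S\<close> and those from \<open>T\<close> are collected and renormalised
  separately.\<close>

lemma convex_hull_Un_memE:
  assumes S: "convex S" "S \<noteq> {}" and T: "convex T" "T \<noteq> {}" and y: "y \<in> convex hull (S \<union> T)"
  obtains u v s t where "0 \<le> u" "0 \<le> v" "u + v = 1" "s \<in> S" "t \<in> T" "y = u *\<^sub>R s + v *\<^sub>R t"
proof -
  define J where
    "J = {y. \<exists>u v s t. 0 \<le> u \<and> 0 \<le> v \<and> u + v = 1 \<and> s \<in> S \<and> t \<in> T \<and> y = u *\<^sub>R s + v *\<^sub>R t}"
  have JI: "u *\<^sub>R s + v *\<^sub>R t \<in> J" if "0 \<le> u" "0 \<le> v" "u + v = 1" "s \<in> S" "t \<in> T" for u v s t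
    using that unfolding J_def by blast
  have "S \<union> T \<subseteq> J"
    using S(2) T(2) JI[of 1 0] JI[of 0 1] by auto
  moreover have "convex J"
  proof (rule convexI)
    fix x y and a b :: real
    assume xy: "x \<in> J" "y \<in> J" and ab: "0 \<le> a" "0 \<le> b" "a + b = 1"
    obtain u v s t where x: "0 \<le> u" "0 \<le> v" "u + v = 1" "s \<in> S" "t \<in> T" "x = u *\<^sub>R s + v *\<^sub>R t"
      using xy(1) unfolding J_def by blast
    obtain u' v' s' t' where y: "0 \<le> u'" "0 \<le> v'" "u' + v' = 1" "s' \<in> S" "t' \<in> T"
        "y = u' *\<^sub>R s' + v' *\<^sub>R t'"
      using xy(2) unfolding J_def by blast
    obtain s0 where s0: "s0 \<in> S" "(a * u) *\<^sub>R s + (b * u') *\<^sub>R s' = (a * u + b * u') *\<^sub>R s0"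
      using convex_nonneg_combination[OF S(1) x(4) y(4), of "a * u" "b * u'"] x y ab by auto
    obtain t0 where t0: "t0 \<in> T" "(a * v) *\<^sub>R t + (b * v') *\<^sub>R t' = (a * v + b * v') *\<^sub>R t0"
      using convex_nonneg_combination[OF T(1) x(5) y(5), of "a * v" "b * v'"] x y ab by auto
    have "a * u + b * u' + (a * v + b * v') = a * (u + v) + b * (u' + v')"
      by (simp add: algebra_simps)
    hence "(a * u + b * u') *\<^sub>R s0 + (a * v + b * v') *\<^sub>R t0 \<in> J"
      using x y ab s0 t0 by (intro JI) auto
    moreover have "a *\<^sub>R x + b *\<^sub>R y
        = ((a * u) *\<^sub>R s + (b * u') *\<^sub>R s') + ((a * v) *\<^sub>R t + (b * v') *\<^sub>R t')"
      unfolding x(6) y(6) by (simp add: scaleR_add_right)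
    ultimately show "a *\<^sub>R x + b *\<^sub>R y \<in> J" unfolding s0(2) t0(2) by simp
  qed
  ultimately have "convex hull (S \<union> T) \<subseteq> J" by (rule hull_minimal)
  with y that show thesis unfolding J_def by blast
qed

text \<open>The convex hull \<open>C\<close> of \<open>D \<union> V\<close> is a neighbourhood of the origin in the whole space with
  \<open>C \<inter> L = D\<close>, so the functional extending the gauge of \<open>D\<close> is automatically continuous.\<close>

lemma radial_support_functional:
  fixes D V L :: "'a :: real_tvs set"
  assumes D: "closed D" "convex D" "D \<subseteq> L" and L: "subspace L"
    and V: "open V" "convex V" "0 \<in> V" "V \<inter> L \<subseteq> D"
    and x: "x \<in> L" "x \<notin> D"
  obtains f z r where "f \<in> dual_space" "\<forall>y\<in>D. f y \<le> 1"
    "z \<in> D" "f z = 1" "1 < r" "x = r *\<^sub>R z"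
proof -
  define C where "C = convex hull (D \<union> V)"
  define p where "p = minkowski C"
  have C: "convex C" by (simp add: C_def)
  have VC: "V \<subseteq> C" and DC: "D \<subseteq> C" unfolding C_def by (auto intro: hull_inc)
  have "0 \<in> D" using V L by (auto dest: subspace_0)
  have CL: "y \<in> D" if y: "y \<in> C" "y \<in> L" for y
  proof -
    obtain u v d w where uv: "0 \<le> u" "0 \<le> v" "u + v = 1" and dw: "d \<in> D" "w \<in> V"
      and y_eq: "y = u *\<^sub>R d + v *\<^sub>R w"
      using convex_hull_Un_memE[OF D(2) _ V(2) _ y(1)[unfolded C_def]] \<open>0 \<in> D\<close> V(3) by blast
    show ?thesis
    proof (cases "v = 0")
      case True
      with y_eq uv dw show ?thesis by simp
    next
      case False
      \<comment> \<open>Solving for \<open>w\<close> places it in the subspace \<open>L\<close>,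
        where \<open>V\<close> is contained in \<open>D\<close>.\<close>
      have "inverse v *\<^sub>R (y - u *\<^sub>R d) \<in> L"
        using y(2) dw D(3) L by (intro subspace_scale subspace_diff) auto
      hence "w \<in> L" using False y_eq by simp
      with dw V have "w \<in> D" by blast
      with y_eq uv dw D(2) show ?thesis by (auto intro: convexD)
    qed
  qed
  have absorb: "\<exists>s>0. inverse s *\<^sub>R y \<in> C" for y
    using open_absorbing[OF V(1,3), of y] VC by blast
  have p: "sublinear p" unfolding p_def using C absorb by (rule sublinear_minkowski)
  have p_le: "p y \<le> 1" if "y \<in> C" for y
    unfolding p_def using that by (intro minkowski_le) auto
  obtain f where f: "linear f" "\<And>y. f y \<le> p y" "f x = p x"
    using hahn_banach_point[OF p] by blast
  have f_le: "f y \<le> 1" if "y \<in> C" for y using f(2)[of y] p_le[OF that] by simp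
  have "continuous_on UNIV f"
    using f(1) V(1,3) by (rule linear_bounded_above_continuous) (use f_le VC in auto)
  hence dual: "f \<in> dual_space" using f(1) by (simp add: dual_space_def)
  \<comment> \<open>The gauge value of \<open>x\<close> locates the exit point: the ray through
    \<open>x\<close> leaves \<open>D\<close> at \<open>inverse r *\<^sub>R x\<close>.\<close>
  define r where "r = p x"
  have mem: "inverse s *\<^sub>R x \<in> D" if "r < s" for s
    using that x(1) L unfolding r_def p_def
    by (intro CL minkowski_less_imp_mem[OF C absorb] subspace_scale)
  have "1 \<le> r" using mem[of 1] x(2) by force
  have z: "inverse r *\<^sub>R x \<in> D"
  proof -
    \<comment> \<open>Membership is known only for \<open>s > r\<close>; letting \<open>s\<close>
      decrease to \<open>r\<close> and using that \<open>D\<close> is closed gives the exit point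
      itself.\<close>
    have "((\<lambda>s. inverse s *\<^sub>R x) \<longlongrightarrow> inverse r *\<^sub>R x) (at_right r)"
    proof -
      have "continuous_on {0<..} (\<lambda>s. inverse s *\<^sub>R x)"
        by (intro continuous_intros) auto
      hence "((\<lambda>s. inverse s *\<^sub>R x) \<longlongrightarrow> inverse r *\<^sub>R x) (at r)"
        using \<open>1 \<le> r\<close> by (simp add: continuous_on_def at_within_open[where S = "{0<..}"])
      thus ?thesis by (rule tendsto_mono[OF at_le, rotated]) simp
    qed
    moreover have "\<forall>\<^sub>F s in at_right r. inverse s *\<^sub>R x \<in> D"
      using eventually_at_right_less by eventually_elim (rule mem)
    ultimately show ?thesis
      using D(1) by (intro Lim_in_closed_set) auto
  qed
  have "r \<noteq> 1" using z x(2) by auto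
  with \<open>1 \<le> r\<close> have "1 < r" by simp
  moreover have "f (inverse r *\<^sub>R x) = 1"
    using \<open>1 < r\<close> by (simp add: linear_scale[OF f(1)] f(3) r_def)
  moreover have "x = r *\<^sub>R (inverse r *\<^sub>R x)" using \<open>1 < r\<close> by simp
  ultimately show thesis using that[OF dual _ z] f_le DC by blast
qed

section \<open>Faces, half-spaces and the final assembly\<close>

lemma face_of_linear_maximum:
  fixes f :: "'a :: real_vector \<Rightarrow> real"
  assumes f: "linear f" and S: "convex S" and le: "\<And>x. x \<in> S \<Longrightarrow> f x \<le> c"
  shows "{x \<in> S. f x = c} face_of S"
  unfolding face_of_def
proof (intro conjI ballI impI)
  have "convex (S \<inter> f -` {c})"
    using S f by (intro convex_Int convex_linear_vimage) auto
  thus "convex {x \<in> S. f x = c}" by (simp add: Int_def vimage_def)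
next
  fix a b x assume ab: "a \<in> S" "b \<in> S" and x: "x \<in> {x \<in> S. f x = c}" "x \<in> open_segment a b"
  then obtain u where u: "0 < u" "u < 1" "x = (1 - u) *\<^sub>R a + u *\<^sub>R b"
    by (auto simp: in_segment)
  have "(1 - u) * f a + u * f b = c"
    using x(1) by (simp add: u(3) linear_add[OF f] linear_scale[OF f])
  hence eq: "(1 - u) * (c - f a) + u * (c - f b) = 0" by (simp add: algebra_simps)
  \<comment> \<open>Two nonnegative terms with sum zero both vanish, and the weights are positive,
    so both endpoints attain the maximum.\<close>
  have "0 \<le> (1 - u) * (c - f a)" "0 \<le> u * (c - f b)"
    using u le ab by auto
  with eq have "(1 - u) * (c - f a) = 0" "u * (c - f b) = 0" by linarith+
  with u ab show "a \<in> {x \<in> S. f x = c}" "b \<in> {x \<in> S. f x = c}" by auto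
qed auto

lemma generalized_polyhedral_convexI:
  assumes "finite T" "\<And>t. t \<in> T \<Longrightarrow> g t \<in> dual_space" "affine L" "closed L"
    and D: "D = {x \<in> L. \<forall>t\<in>T. g t x \<le> \<beta> t}"
  shows "generalized_polyhedral_convex D"
proof -
  obtain h where h: "bij_betw h {1..card T} T"
    using ex_bij_betw_nat_finite_1[OF assms(1)] by blast
  hence T: "T = h ` {1..card T}" by (simp add: bij_betw_def)
  have "\<forall>i\<in>{1..card T}. g (h i) \<in> dual_space" using assms(2) T by blast
  moreover have "D = {x. x \<in> L \<and> (\<forall>i\<in>{1..card T}. g (h i) x \<le> \<beta> (h i))}"
    unfolding D by (subst T) auto
  ultimately show ?thesis
    unfolding generalized_polyhedral_convex_def using assms(3,4)
    by (intro exI[of _ "card T"] exI[of _ "\<lambda>i. g (h i)"] exI[of _ "\<lambda>i. \<beta> (h i)"] exI[of _ L]) simp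
qed

theorem theorem2p6:
  fixes D :: "'a :: {real_lctvs, t2_space} set"
  assumes "closed D" and "convex D"
    and "relative_interior D \<noteq> {}"
    and "finite {F. F face_of D}"
  shows "generalized_polyhedral_convex D"
proof -
  define L where "L = closure (affine hull D)"
  have L: "affine L" "closed L"
    unfolding L_def by (simp_all add: affine_closure_tvs)
  have DL: "D \<subseteq> L"
    unfolding L_def using hull_subset closure_subset by (rule order_trans)
  obtain u S where S: "open S" "u \<in> S" "u \<in> L" "L \<inter> S \<subseteq> D"
    using assms(3) by (auto simp: relative_interior_def interior_of_def L_def[symmetric] openin_open)
  have "open ((+) u -` S)" using S(1) by (intro open_vimage continuous_intros)
  then obtain V where V: "open V" "convex V" "0 \<in> V" "V \<subseteq> (+) u -` S"
    using convex_nhd_zero S(2) by (metis vimageI add.right_neutral)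
  \<comment> \<open>Translating by \<open>- u\<close> turns the closed affine hull into a subspace
    in which \<open>D0\<close> is a neighbourhood of the origin, the setting of
    \<open>radial_support_functional\<close>.\<close>
  define D0 where "D0 = (+) u -` D"
  define L0 where "L0 = (+) u -` L"
  have D0: "closed D0" "D0 \<subseteq> L0"
    unfolding D0_def L0_def using assms(1) DL by (auto intro!: closed_vimage continuous_intros)
  have "D0 = (+) (- u) ` D"
    unfolding D0_def by (auto simp: image_iff intro!: bexI[of _ "u + _"])
  hence "convex D0" using assms(2) by (simp add: convex_translation)
  have "L0 = (\<lambda>x. x - u) ` L"
    unfolding L0_def by (auto simp: image_iff intro!: bexI[of _ "u + _"])
  hence "subspace L0" using affine_diffs_subspace_subtract[OF L(1) S(3)] by simp
  have "V \<inter> L0 \<subseteq> D0" using V(4) S(4) by (auto simp: L0_def D0_def)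
  note support = radial_support_functional[OF D0(1) \<open>convex D0\<close> D0(2) \<open>subspace L0\<close> V(1-3) this]
  \<comment> \<open>The bound 1 for functionals on \<open>D0\<close> becomes \<open>f u + 1\<close>
    on \<open>D\<close>. This normalisation builds in a strict gap at \<open>u\<close>. The bound
    need not be attained: an empty \<open>F\<close> is still a face.\<close>
  define supp where "supp F f \<longleftrightarrow> f \<in> dual_space \<and> (\<forall>y\<in>D. f y \<le> f u + 1) \<and>
    F = {y \<in> D. f y = f u + 1}" for F f
  define T where "T = {F. \<exists>f. supp F f}"
  have "T \<subseteq> {F. F face_of D}"
    using assms(2) by (auto simp: T_def supp_def dual_space_def intro!: face_of_linear_maximum)
  hence "finite T" using assms(4) by (rule finite_subset)
  define g where "g F = (SOME f. supp F f)" for F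
  have g: "supp F (g F)" if "F \<in> T" for F
    using someI_ex[of "supp F"] that by (simp add: T_def g_def)
  have "x \<in> D" if x: "x \<in> L" and le: "\<And>F. F \<in> T \<Longrightarrow> g F x \<le> g F u + 1" for x
  proof (rule ccontr)
    assume "x \<notin> D"
    hence "x - u \<in> L0" "x - u \<notin> D0" using x by (auto simp: L0_def D0_def)
    then obtain f z r where f: "f \<in> dual_space" "\<forall>y\<in>D0. f y \<le> 1"
      "z \<in> D0" "f z = 1" "1 < r" "x - u = r *\<^sub>R z"
      by (rule support)
    have f_lin: "linear f" using f(1) by (simp add: dual_space_def)
    define F where "F = {y \<in> D. f y = f u + 1}"
    have "f y \<le> f u + 1" if "y \<in> D" for y
      using bspec[OF f(2), of "y - u"] that by (simp add: D0_def linear_diff[OF f_lin])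
    hence "supp F f" using f(1) by (auto simp: supp_def F_def)
    hence F: "F \<in> T" by (auto simp: T_def)
    have "u + z \<in> F"
      using f(3,4) by (simp add: F_def D0_def linear_add[OF f_lin])
    have lin: "linear (g F)" using g[OF F] by (simp add: supp_def dual_space_def)
    \<comment> \<open>The functional \<open>f\<close> has served only to identify the face
      \<open>F\<close>. The chosen \<open>g F\<close> has the same contact set, so it too rises by
      exactly 1 from \<open>u\<close> to \<open>u + z\<close>, and by \<open>r > 1\<close> from
      \<open>u\<close> to \<open>x\<close>.\<close>
    have "g F (u + z) = g F u + 1" using g[OF F] \<open>u + z \<in> F\<close> unfolding supp_def by blast
    hence "g F z = 1" by (simp add: linear_add[OF lin])
    moreover have "x = u + r *\<^sub>R z" using f(6) by (simp add: algebra_simps)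
    ultimately have "g F x = g F u + r"
      by (simp add: linear_add[OF lin] linear_scale[OF lin])
    with le[OF F] f(5) show False by simp
  qed
  hence "D = {x \<in> L. \<forall>F\<in>T. g F x \<le> g F u + 1}"
    using DL g by (auto simp: supp_def)
  with \<open>finite T\<close> L g show ?thesis
    by (intro generalized_polyhedral_convexI[where T = T and g = g and L = L]) (auto simp: supp_def)
qed

end
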